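(* Let $n,l\ge 1$ be integers, $C>0$, $\epsilon>0$, $x_1,\dots,x_l\in\mathbb{R}^n$. Let $f:\mathbb{R}^n\to\mathbb{R}$ be either (a) $f(\omega)=f_1(\omega):=\frac12\|\omega\|^2+C\sum_{i=1}^l \max(1-y_i\,\omega^Tx_i,\,0)^2$ with labels $y_1,\dots,y_l\in\{-1,1\}$, or (b) $f(\omega)=f_2(\omega):=\frac12\|\omega\|^2+C\sum_{i=1}^l \max(|\omega^Tx_i-y_i|-\epsilon,\,0)^2$ with observations $y_1,\dots,y_l\in\mathbb{R}$. Let $\omega^*$ be a solution of $\nabla f(\omega)=0$. Then the semismooth Newton method for $\nabla f(\omega)=0$ is locally quadratically convergent to $\omega^*$: there exist $\delta>0$ and $K>0$ such that, whenever $\|\omega^0-\omega^*\|\le\delta$, every sequence generated by $$\omega^{k+1}=\omega^k-V_k^{-1}\nabla f(\omega^k),\qquad V_k\in\partial^2 f(\omega^k),\qquad k=0,1,2,\dots,$$ is well defined, converges to $\omega^*$, and satisfies $\|\omega^{k+1}-\omega^*\|\le K\|\omega^k-\omega^*\|^2$ for all $k\ge 0$.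
   Context: Here $\|\cdot\|$ is the Euclidean norm. Both $f_1$ and $f_2$ are continuously differentiable with locally Lipschitz gradient. For a locally Lipschitz map $\Phi:\mathbb{R}^n\to\mathbb{R}^n$, let $D_\Phi$ be the set of points at which $\Phi$ is differentiable (its complement has measure zero by Rademacher's theorem). The Bouligand subdifferential $\partial_B\Phi(x)$ is the set of all accumulation points of $\Phi'(x^k)$ over sequences $x^k\to x$ with $x^k\in D_\Phi$, where $\Phi'$ is the Jacobian matrix. The Clarke generalized Jacobian is the convex hull $\partial\Phi(x)=\mathrm{co}\,\partial_B\Phi(x)$. The notation $\partial^2 f(\omega)$ means the Clarke generalized Jacobian at $\omega$ of the gradient map $\nabla f$. *)

theory Defs
  imports "HOL-Analysis.Analysis"
begin

definition gradient :: "('a::real_inner \<Rightarrow> real) \<Rightarrow> 'a \<Rightarrow> 'a" where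
  "gradient f w = (THE D. GDERIV f w :> D)"

(* "THE" above is harmless: a gradient is unique whenever it exists. *)
lemma gradient_eqI:
  assumes "GDERIV f w :> D"
  shows "gradient f w = D"
  unfolding gradient_def
proof (rule the_equality)
  fix E assume "GDERIV f w :> E"
  then have "(\<lambda>h. inner h E) = (\<lambda>h. inner h D)"
    using assms unfolding gderiv_def by (rule has_derivative_unique)
  then have "inner (E - D) E = inner (E - D) D"
    by (rule fun_cong)
  then have "inner (E - D) (E - D) = 0"
    by (simp add: inner_diff_right)
  then show "E = D"
    by simp
qed (rule assms)

definition bouligand_subdifferential ::
    "(real ^ 'n \<Rightarrow> real ^ 'm) \<Rightarrow> real ^ 'n \<Rightarrow> (real ^ 'n ^ 'm) set" where
  "bouligand_subdifferential \<Phi> x =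
    {A. \<exists>X r. (\<forall>k. \<Phi> differentiable (at (X k))) \<and> X \<longlonglongrightarrow> x \<and>
          strict_mono (r :: nat \<Rightarrow> nat) \<and> (\<lambda>k. jacobian \<Phi> (at (X (r k)))) \<longlonglongrightarrow> A}"

definition clarke_jacobian ::
    "(real ^ 'n \<Rightarrow> real ^ 'm) \<Rightarrow> real ^ 'n \<Rightarrow> (real ^ 'n ^ 'm) set" where
  "clarke_jacobian \<Phi> x = convex hull (bouligand_subdifferential \<Phi> x)"

definition generalized_hessian :: "(real ^ 'n \<Rightarrow> real) \<Rightarrow> real ^ 'n \<Rightarrow> (real ^ 'n ^ 'n) set" where
  "generalized_hessian f w = clarke_jacobian (gradient f) w"

definition l2_svc_objective ::
    "real \<Rightarrow> nat \<Rightarrow> (nat \<Rightarrow> real ^ 'n) \<Rightarrow> (nat \<Rightarrow> real) \<Rightarrow> real ^ 'n \<Rightarrow> real" where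
  "l2_svc_objective C l x y w =
    1 / 2 * (norm w)\<^sup>2 + C * (\<Sum>i=1..l. (max (1 - y i * (w \<bullet> x i)) 0)\<^sup>2)"

definition l2_svr_objective ::
    "real \<Rightarrow> real \<Rightarrow> nat \<Rightarrow> (nat \<Rightarrow> real ^ 'n) \<Rightarrow> (nat \<Rightarrow> real) \<Rightarrow> real ^ 'n \<Rightarrow> real" where
  "l2_svr_objective C \<epsilon> l x y w =
    1 / 2 * (norm w)\<^sup>2 + C * (\<Sum>i=1..l. (max (\<bar>w \<bullet> x i - y i\<bar> - \<epsilon>) 0)\<^sup>2)"

(* Invertibility is required explicitly because matrix_inv is an arbitrary matrix
   when its argument is singular. *)
definition newton_step ::
    "(real ^ 'n \<Rightarrow> real) \<Rightarrow> real ^ 'n \<Rightarrow> real ^ 'n ^ 'n \<Rightarrow> real ^ 'n \<Rightarrow> bool" where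
  "newton_step f w V w' \<longleftrightarrow>
    V \<in> generalized_hessian f w \<and> invertible V \<and> w' = w - matrix_inv V *v gradient f w"

(* The iteration started at w0 never breaks down: after any finite number N of steps, with any
   choice of the matrices, a next matrix can be chosen and every admissible choice is invertible. *)
definition newton_well_defined :: "(real ^ 'n \<Rightarrow> real) \<Rightarrow> real ^ 'n \<Rightarrow> bool" where
  "newton_well_defined f w0 \<longleftrightarrow>
    (\<forall>N w V. w 0 = w0 \<and> (\<forall>k<N. newton_step f (w k) (V k) (w (Suc k))) \<longrightarrow>
      generalized_hessian f (w N) \<noteq> {} \<and> (\<forall>A \<in> generalized_hessian f (w N). invertible A))"

end

theory Submission
  imports Defs
begin

text \<open>
Both objectives are of the form \<open>1/2 |w|^2 + C * (sum over j of max (a_j . w - b_j) 0 ^ 2)\<close> with finitely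
many affine forms; for the regression loss this uses that, for \<open>\<epsilon> \<ge> 0\<close>, at most one of \<open>t - \<epsilon>\<close> and
\<open>-t - \<epsilon>\<close> is positive. The gradient \<open>g\<close> of such a function is piecewise affine, and this gives much
more than quadratic convergence: near a zero \<open>z\<close> of \<open>g\<close> every Newton step lands exactly on \<open>z\<close>.

The reason is the secant identity \<open>V (w - z) = g w - g z\<close>, valid for all \<open>w\<close> near \<open>z\<close> and all \<open>V\<close> in
the Clarke Jacobian of \<open>g\<close> at \<open>w\<close> (\<open>clarke_jacobian_secant\<close>). A form that is nonzero at \<open>z\<close> has
the same sign at \<open>w\<close> and at all points near \<open>w\<close>, so its hinge is affine on the relevant region. A form
that vanishes at \<open>z\<close> either vanishes at \<open>w\<close> too, and then contributes zero to both sides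
whatever weight \<open>V\<close> gives it, or has a constant sign near \<open>w\<close>, and then contributes linearly along the
segment from \<open>z\<close> to \<open>w\<close>.

Moreover every such \<open>V\<close> dominates the identity (\<open>clarke_jacobian_coercive\<close>), hence is invertible, and
\<open>w - inverse V (g w) = w - (w - z) = z\<close>. Well-definedness also needs the Clarke Jacobian to be
nonempty (\<open>clarke_jacobian_hinge_gradient_nonempty\<close>), which holds because \<open>g\<close> is differentiable off
finitely many hyperplanes with bounded Jacobians.

The identity and the coercivity are both closed convex conditions on \<open>V\<close>, so they
pass from Jacobians at points of differentiability to limits and convex hulls
(\<open>clarke_jacobian_subsetI\<close>). The points of differentiability need care: \<open>g\<close> can be differentiable at a
point where some forms vanish, because their kinks can cancel. The matrix
\<open>hinge_hessian\<close> covers these points as well (\<open>jacobian_hinge_gradient\<close>).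
\<close>

section \<open>Sums of squared hinges\<close>

lemma hinge_square_deriv:
  "((\<lambda>t::real. (max t 0)\<^sup>2) has_real_derivative 2 * max u 0) (at u)"
proof -
  \<comment> \<open>The derivative is Lipschitz with constant 2, so the difference quotient errs by at most \<open>|h|\<close>.\<close>
  have bound: "\<bar>((max (u + h) 0)\<^sup>2 - (max u 0)\<^sup>2) / h - 2 * max u 0\<bar> \<le> \<bar>h\<bar>" if "h \<noteq> 0" for h
  proof -
    have "\<bar>(max (u + h) 0)\<^sup>2 - (max u 0)\<^sup>2 - 2 * max u 0 * h\<bar> \<le> h\<^sup>2"
    proof (cases "u \<ge> 0")
      case True
      then show ?thesis
      proof (cases "u + h \<ge> 0")
        case True
        with \<open>u \<ge> 0\<close> show ?thesis by (simp add: max_def power2_eq_square algebra_simps)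
      next
        case False
        have "\<bar>- u\<^sup>2 - 2 * u * h\<bar> \<le> h\<^sup>2"
        proof (rule abs_leI)
          have "0 \<le> (u + h)\<^sup>2" by simp
          then show "- u\<^sup>2 - 2 * u * h \<le> h\<^sup>2" by (simp add: power2_eq_square algebra_simps)
          have "u * u \<le> h * h" using False True mult_mono[of u "-h" u "-h"] by auto
          moreover have "u * h \<le> 0" using False True by (intro mult_nonneg_nonpos) auto
          ultimately show "- (- u\<^sup>2 - 2 * u * h) \<le> h\<^sup>2"
            by (simp add: power2_eq_square)
        qed
        with False True show ?thesis by (simp add: max_def)
      qed
    next
      case False
      then show ?thesis
        by (auto simp: max_def abs_le_square_iff[symmetric])
    qed
    moreover have "((max (u + h) 0)\<^sup>2 - (max u 0)\<^sup>2) / h - 2 * max u 0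
        = ((max (u + h) 0)\<^sup>2 - (max u 0)\<^sup>2 - 2 * max u 0 * h) / h"
      using that by (simp add: field_simps)
    ultimately show ?thesis
      using that by (simp add: abs_divide divide_le_eq power2_eq_square flip: abs_mult)
  qed
  have "((\<lambda>h. ((max (u + h) 0)\<^sup>2 - (max u 0)\<^sup>2) / h - 2 * max u 0) \<longlongrightarrow> 0) (at 0)"
  proof (rule Lim_null_comparison)
    show "\<forall>\<^sub>F h in at 0. norm (((max (u + h) 0)\<^sup>2 - (max u 0)\<^sup>2) / h - 2 * max u 0) \<le> \<bar>h\<bar>"
      using bound by (simp add: eventually_at_filter)
    show "((\<lambda>h::real. \<bar>h\<bar>) \<longlongrightarrow> 0) (at 0)"
      using tendsto_rabs[OF tendsto_ident_at[of "0::real" UNIV]] by simp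
  qed
  then show ?thesis unfolding DERIV_def by (rule LIM_zero_cancel)
qed

definition hinge_objective :: "real \<Rightarrow> 'j set \<Rightarrow> ('j \<Rightarrow> real ^ 'n) \<Rightarrow> ('j \<Rightarrow> real) \<Rightarrow> real ^ 'n \<Rightarrow> real" where
  "hinge_objective C J a b w = 1 / 2 * (norm w)\<^sup>2 + C * (\<Sum>j\<in>J. (max (a j \<bullet> w - b j) 0)\<^sup>2)"

definition hinge_gradient :: "real \<Rightarrow> 'j set \<Rightarrow> ('j \<Rightarrow> real ^ 'n) \<Rightarrow> ('j \<Rightarrow> real) \<Rightarrow> real ^ 'n \<Rightarrow> real ^ 'n" where
  "hinge_gradient C J a b w = w + (2 * C) *\<^sub>R (\<Sum>j\<in>J. max (a j \<bullet> w - b j) 0 *\<^sub>R a j)"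

definition outer_square :: "real ^ 'n \<Rightarrow> real ^ 'n ^ 'n" where
  "outer_square u = (\<chi> i k. u $ i * u $ k)"

text \<open>
At a kink the weight is \<open>1/2\<close>, since \<open>sgn 0 = 0\<close>. This is the value that makes
\<open>hinge_hessian\<close> the Jacobian at every point of differentiability, including those
where kinks of several hinges cancel, as in \<open>max t 0 - max (- t) 0 = t\<close>.
\<close>

definition hinge_hessian :: "real \<Rightarrow> 'j set \<Rightarrow> ('j \<Rightarrow> real ^ 'n) \<Rightarrow> ('j \<Rightarrow> real) \<Rightarrow> real ^ 'n \<Rightarrow> real ^ 'n ^ 'n" where
  "hinge_hessian C J a b w =
    mat 1 + (2 * C) *\<^sub>R (\<Sum>j\<in>J. ((1 + sgn (a j \<bullet> w - b j)) / 2) *\<^sub>R outer_square (a j))"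

section \<open>Gradient and Jacobian\<close>

lemma gradient_hinge_objective:
  "gradient (hinge_objective C J a b) = hinge_gradient C J a b"
proof
  fix w
  have "((\<lambda>w. (max (a j \<bullet> w - b j) 0)\<^sup>2) has_derivative (\<lambda>h. 2 * max (a j \<bullet> w - b j) 0 * (a j \<bullet> h))) (at w)" for j
  proof -
    have "((\<lambda>w. a j \<bullet> w - b j) has_derivative (\<lambda>h. a j \<bullet> h)) (at w)"
      by (auto intro!: derivative_eq_intros)
    from has_derivative_compose[OF this
      hinge_square_deriv[unfolded has_field_derivative_def, of "a j \<bullet> w - b j"]]
    show ?thesis by simp
  qed
  then have "(hinge_objective C J a b has_derivative
     (\<lambda>h. 1 / 2 * (w \<bullet> h + h \<bullet> w) + C * (\<Sum>j\<in>J. 2 * max (a j \<bullet> w - b j) 0 * (a j \<bullet> h)))) (at w)"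
    unfolding hinge_objective_def power2_norm_eq_inner
    by (intro has_derivative_add has_derivative_mult_right has_derivative_sum
      has_derivative_inner has_derivative_ident)
  moreover have "(\<lambda>h. 1 / 2 * (w \<bullet> h + h \<bullet> w) + C * (\<Sum>j\<in>J. 2 * max (a j \<bullet> w - b j) 0 * (a j \<bullet> h)))
      = (\<lambda>h. h \<bullet> hinge_gradient C J a b w)"
    by (auto simp: hinge_gradient_def inner_add_right inner_sum_right sum_distrib_left inner_commute mult_ac)
  ultimately show "gradient (hinge_objective C J a b) w = hinge_gradient C J a b w"
    by (intro gradient_eqI) (simp add: gderiv_def)
qed

lemma linear_matrix_vector_mult_left: "linear (\<lambda>A :: real ^ 'n ^ 'm. A *v h)"
  by (rule linearI) (auto simp: matrix_vector_mult_add_rdistrib scaleR_matrix_vector_assoc)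

lemma hinge_hessian_mult:
  fixes h :: "real ^ 'n"
  shows "hinge_hessian C J a b w *v h =
    h + (2 * C) *\<^sub>R (\<Sum>j\<in>J. ((1 + sgn (a j \<bullet> w - b j)) / 2 * (a j \<bullet> h)) *\<^sub>R a j)"
proof -
  have outer: "outer_square u *v h = (u \<bullet> h) *\<^sub>R u" for u :: "real ^ 'n"
    by (auto simp: vec_eq_iff outer_square_def matrix_vector_mult_def inner_vec_def sum_distrib_left mult_ac)
  interpret L: linear "\<lambda>A :: real ^ 'n ^ 'n. A *v h" by (rule linear_matrix_vector_mult_left)
  show ?thesis
    by (simp add: hinge_hessian_def L.add L.scale L.sum outer)
qed

text \<open>
The symmetric difference quotients of a hinge are eventually constant: for small \<open>s\<close>,
\<open>max (u + s) 0 - max (u - s) 0 = (1 + sgn u) * s\<close>, also for \<open>u = 0\<close>. Symmetric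
differences therefore compute the derivative wherever it exists, without deciding which
combinations of kinks cancel.
\<close>

lemma jacobian_hinge_gradient:
  assumes "finite J" and diff: "hinge_gradient C J a b differentiable (at X)"
  shows "jacobian (hinge_gradient C J a b) (at X) = hinge_hessian C J a b X"
proof -
  let ?g = "hinge_gradient C J a b"
  let ?A = "jacobian ?g (at X)"
  have der: "(?g has_derivative (\<lambda>h. ?A *v h)) (at X)"
    using diff by (simp add: jacobian_works)
  have "?A *v h = hinge_hessian C J a b X *v h" for h
  proof -
    have lin: "((\<lambda>t. X + t *\<^sub>R h) has_derivative (\<lambda>t. t *\<^sub>R h)) (at 0)" for h
      by (auto intro!: derivative_eq_intros)
    have "((\<lambda>t. ?g (X + t *\<^sub>R h)) has_derivative (\<lambda>t. ?A *v (t *\<^sub>R h))) (at 0)" for h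
      using has_derivative_compose[OF lin, of ?g "\<lambda>h. ?A *v h"] der by simp
    from has_derivative_diff[OF this[of h] this[of "-h"]]
    have "((\<lambda>t. ?g (X + t *\<^sub>R h) - ?g (X - t *\<^sub>R h)) has_derivative (\<lambda>t. t *\<^sub>R (2 *\<^sub>R (?A *v h)))) (at 0)"
      by (simp add: matrix_vector_mult_scaleR scaleR_2 scaleR_add_right linear_neg[OF matrix_vector_mul_linear])
    then have 1: "((\<lambda>t. ?g (X + t *\<^sub>R h) - ?g (X - t *\<^sub>R h)) has_vector_derivative 2 *\<^sub>R (?A *v h)) (at 0)"
      by (simp add: has_vector_derivative_def)
    have "\<forall>\<^sub>F t::real in nhds 0. max (a j \<bullet> (X + t *\<^sub>R h) - b j) 0 - max (a j \<bullet> (X - t *\<^sub>R h) - b j) 0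
        = t * (1 + sgn (a j \<bullet> X - b j)) * (a j \<bullet> h)" for j
    proof (cases "a j \<bullet> X - b j = 0")
      case True
      then show ?thesis
        by (intro always_eventually) (auto simp: inner_add_right inner_diff_right max_def)
    next
      case False
      have "((\<lambda>t::real. \<bar>t * (a j \<bullet> h)\<bar>) \<longlongrightarrow> \<bar>0 * (a j \<bullet> h)\<bar>) (nhds 0)"
        by (intro tendsto_intros filterlim_ident)
      then have "\<forall>\<^sub>F t::real in nhds 0. \<bar>t * (a j \<bullet> h)\<bar> < \<bar>a j \<bullet> X - b j\<bar>"
        by (rule order_tendstoD) (use False in simp)
      then show ?thesis
      proof eventually_elim
        case (elim t)
        then show ?case
          by (cases "a j \<bullet> X - b j > 0")
             (auto simp: inner_add_right inner_diff_right max_def abs_less_iff algebra_simps)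
      qed
    qed
    then have "\<forall>\<^sub>F t::real in nhds 0. \<forall>j\<in>J. max (a j \<bullet> (X + t *\<^sub>R h) - b j) 0 - max (a j \<bullet> (X - t *\<^sub>R h) - b j) 0
        = t * (1 + sgn (a j \<bullet> X - b j)) * (a j \<bullet> h)"
      using \<open>finite J\<close> by (simp add: eventually_ball_finite)
    then have "\<forall>\<^sub>F t::real in nhds 0. ?g (X + t *\<^sub>R h) - ?g (X - t *\<^sub>R h) = t *\<^sub>R (2 *\<^sub>R (hinge_hessian C J a b X *v h))"
    proof eventually_elim
      case (elim t)
      have "?g (X + t *\<^sub>R h) - ?g (X - t *\<^sub>R h)
        = (2 * t) *\<^sub>R h + (2 * C) *\<^sub>R (\<Sum>j\<in>J. (max (a j \<bullet> (X + t *\<^sub>R h) - b j) 0 - max (a j \<bullet> (X - t *\<^sub>R h) - b j) 0) *\<^sub>R a j)"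
        by (simp add: hinge_gradient_def scaleR_diff_left sum_subtractf scaleR_diff_right algebra_simps
            flip: scaleR_scaleR)
           (simp add: scaleR_2 algebra_simps flip: scaleR_left_distrib mult_2_right)
      also have "\<dots> = (2 * t) *\<^sub>R h + (2 * C) *\<^sub>R (\<Sum>j\<in>J. (t * (1 + sgn (a j \<bullet> X - b j)) * (a j \<bullet> h)) *\<^sub>R a j)"
        using elim by simp
      also have "\<dots> = t *\<^sub>R (2 *\<^sub>R (hinge_hessian C J a b X *v h))"
        by (simp add: hinge_hessian_mult scaleR_add_right scaleR_sum_right mult_ac)
      finally show ?case .
    qed
    then have "((\<lambda>t. ?g (X + t *\<^sub>R h) - ?g (X - t *\<^sub>R h)) has_vector_derivative 2 *\<^sub>R (hinge_hessian C J a b X *v h)) (at 0)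
      \<longleftrightarrow> ((\<lambda>t::real. t *\<^sub>R (2 *\<^sub>R (hinge_hessian C J a b X *v h))) has_vector_derivative 2 *\<^sub>R (hinge_hessian C J a b X *v h)) (at 0)"
      by (intro has_vector_derivative_cong_ev) (auto simp: eventually_nhds_x_imp_x)
    moreover have "((\<lambda>t::real. t *\<^sub>R (2 *\<^sub>R (hinge_hessian C J a b X *v h))) has_vector_derivative 2 *\<^sub>R (hinge_hessian C J a b X *v h)) (at 0)"
      unfolding has_vector_derivative_def by (rule bounded_linear_imp_has_derivative) (rule bounded_linear_scaleR_left)
    ultimately have "2 *\<^sub>R (?A *v h) = 2 *\<^sub>R (hinge_hessian C J a b X *v h)"
      using 1 vector_derivative_unique_at by blast
    then show ?thesis by simp
  qed
  then show ?thesis by (simp add: matrix_eq)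
qed

section \<open>Elements of the Clarke Jacobian\<close>

lemma clarke_jacobian_subsetI:
  assumes "convex P" "closed P"
    and "\<forall>\<^sub>F X in nhds x. \<Phi> differentiable (at X) \<longrightarrow> jacobian \<Phi> (at X) \<in> P"
  shows "clarke_jacobian \<Phi> x \<subseteq> P"
  unfolding clarke_jacobian_def
proof (rule hull_minimal)
  show "bouligand_subdifferential \<Phi> x \<subseteq> P"
  proof
    fix A assume "A \<in> bouligand_subdifferential \<Phi> x"
    then obtain X and r :: "nat \<Rightarrow> nat" where X: "\<And>k. \<Phi> differentiable (at (X k))" "X \<longlonglongrightarrow> x"
      "strict_mono r" "(\<lambda>k. jacobian \<Phi> (at (X (r k)))) \<longlonglongrightarrow> A"
      unfolding bouligand_subdifferential_def by blast
    have "(X \<circ> r) \<longlonglongrightarrow> x" using X(2,3) by (rule LIMSEQ_subseq_LIMSEQ)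
    then have "\<forall>\<^sub>F k in sequentially. jacobian \<Phi> (at (X (r k))) \<in> P"
      using assms(3) X(1) by (auto simp: filterlim_iff o_def elim!: allE eventually_mono)
    then show "A \<in> P"
      using X(4) by (intro Lim_in_closed_set[OF \<open>closed P\<close>]) auto
  qed
qed (rule \<open>convex P\<close>)

lemma convex_closed_operator_sets:
  shows "convex {A :: real ^ 'n ^ 'm. A *v z = c}" "closed {A :: real ^ 'n ^ 'm. A *v z = c}"
    and "convex {A :: real ^ 'n ^ 'n. \<forall>h. h \<bullet> h \<le> h \<bullet> (A *v h)}"
    and "closed {A :: real ^ 'n ^ 'n. \<forall>h. h \<bullet> h \<le> h \<bullet> (A *v h)}"
proof -
  have cont: "continuous_on UNIV (\<lambda>A :: real ^ 'n ^ 'm. A *v h)" for h :: "real ^ 'n"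
    by (rule linear_continuous_on) (simp add: linear_matrix_vector_mult_left linear_conv_bounded_linear[symmetric])
  have "convex ((\<lambda>A :: real ^ 'n ^ 'm. A *v z) -` {c})"
    by (intro convex_linear_vimage linear_matrix_vector_mult_left) simp
  then show "convex {A :: real ^ 'n ^ 'm. A *v z = c}" by (simp add: vimage_def)
  show "closed {A :: real ^ 'n ^ 'm. A *v z = c}"
    using cont by (intro closed_Collect_eq) auto
  have eq: "{A :: real ^ 'n ^ 'n. \<forall>h. h \<bullet> h \<le> h \<bullet> (A *v h)}
      = (\<Inter>h. (\<lambda>A. A *v h) -` {v. h \<bullet> v \<ge> h \<bullet> h})" by auto
  show "convex {A :: real ^ 'n ^ 'n. \<forall>h. h \<bullet> h \<le> h \<bullet> (A *v h)}"
    unfolding eq by (intro convex_INT convex_linear_vimage linear_matrix_vector_mult_left convex_halfspace_ge)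
  show "closed {A :: real ^ 'n ^ 'n. \<forall>h. h \<bullet> h \<le> h \<bullet> (A *v h)}"
    unfolding eq using linear_matrix_vector_mult_left
    by (intro closed_INT ballI closed_vimage closed_halfspace_ge linear_continuous_on)
      (simp add: linear_conv_bounded_linear[symmetric])
qed

lemma hinge_hessian_coercive:
  assumes "0 \<le> C"
  shows "h \<bullet> h \<le> h \<bullet> (hinge_hessian C J a b X *v h)"
proof -
  have "0 \<le> (\<Sum>j\<in>J. (1 + sgn (a j \<bullet> X - b j)) / 2 * (a j \<bullet> h)\<^sup>2)"
    by (intro sum_nonneg mult_nonneg_nonneg) (auto simp: sgn_real_def)
  moreover have "h \<bullet> (hinge_hessian C J a b X *v h)
      = h \<bullet> h + 2 * C * (\<Sum>j\<in>J. (1 + sgn (a j \<bullet> X - b j)) / 2 * (a j \<bullet> h)\<^sup>2)"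
    by (simp add: hinge_hessian_mult inner_add_right inner_sum_right power2_eq_square inner_commute mult_ac)
  ultimately show ?thesis using assms by simp
qed

lemma eventually_sgn_stable:
  assumes "finite J"
  shows "\<forall>\<^sub>F w in nhds z. \<forall>j\<in>J. a j \<bullet> z \<noteq> b j \<longrightarrow>
           sgn (a j \<bullet> w - b j) = (sgn (a j \<bullet> z - b j) :: real)"
proof (rule eventually_ball_finite[OF assms], rule ballI)
  fix j
  have lim: "((\<lambda>w. a j \<bullet> w - b j) \<longlongrightarrow> a j \<bullet> z - b j) (nhds z)"
    by (intro tendsto_intros filterlim_ident)
  consider "a j \<bullet> z - b j = 0" | "a j \<bullet> z - b j > 0" | "a j \<bullet> z - b j < 0" by linarith
  then show "\<forall>\<^sub>F w in nhds z. a j \<bullet> z \<noteq> b j \<longrightarrow> sgn (a j \<bullet> w - b j) = sgn (a j \<bullet> z - b j)"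
  proof cases
    case 2
    with order_tendstoD(1)[OF lim 2] show ?thesis by (auto elim: eventually_mono)
  next
    case 3
    with order_tendstoD(2)[OF lim 3] show ?thesis by (auto elim: eventually_mono)
  qed simp
qed

text \<open>
Here \<open>X\<close> stands for a point of differentiability near \<open>w\<close>, and \<open>w\<close> is near \<open>z\<close>; the
hypotheses are the sign conditions that \<open>eventually_sgn_stable\<close> provides for the two pairs. A form that
changes sign from \<open>w\<close> to \<open>X\<close> vanishes at \<open>w\<close>, and then also at \<open>z\<close>, so it annihilates \<open>w - z\<close>
and its weight is irrelevant.
\<close>

lemma hinge_hessian_secant:
  assumes "\<And>j. j \<in> J \<Longrightarrow> a j \<bullet> z \<noteq> b j \<Longrightarrow> sgn (a j \<bullet> w - b j) = sgn (a j \<bullet> z - b j)"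
    and "\<And>j. j \<in> J \<Longrightarrow> a j \<bullet> w \<noteq> b j \<Longrightarrow> sgn (a j \<bullet> X - b j) = sgn (a j \<bullet> w - b j)"
  shows "hinge_hessian C J a b X *v (w - z) = hinge_gradient C J a b w - hinge_gradient C J a b z"
proof -
  have "(1 + sgn (a j \<bullet> X - b j)) / 2 * (a j \<bullet> (w - z)) = max (a j \<bullet> w - b j) 0 - max (a j \<bullet> z - b j) 0"
    if "j \<in> J" for j
    using assms[OF that]
    by (cases rule: linorder_cases[of "a j \<bullet> z" "b j"]; cases rule: linorder_cases[of "a j \<bullet> w" "b j"])
      (auto simp: inner_diff_right sgn_real_def)
  then have "(\<Sum>j\<in>J. ((1 + sgn (a j \<bullet> X - b j)) / 2 * (a j \<bullet> (w - z))) *\<^sub>R a j)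
      = (\<Sum>j\<in>J. (max (a j \<bullet> w - b j) 0 - max (a j \<bullet> z - b j) 0) *\<^sub>R a j)"
    by (intro sum.cong) simp_all
  then show ?thesis
    unfolding hinge_hessian_mult hinge_gradient_def
    by (simp add: scaleR_diff_left sum_subtractf scaleR_diff_right)
qed

lemma clarke_jacobian_coercive:
  assumes "finite J" "0 \<le> C" "A \<in> clarke_jacobian (hinge_gradient C J a b) w"
  shows "h \<bullet> h \<le> h \<bullet> (A *v h)"
proof -
  have "clarke_jacobian (hinge_gradient C J a b) w \<subseteq> {A. \<forall>h. h \<bullet> h \<le> h \<bullet> (A *v h)}"
    by (intro clarke_jacobian_subsetI convex_closed_operator_sets always_eventually)
      (auto simp: jacobian_hinge_gradient hinge_hessian_coercive assms)
  with assms show ?thesis by blast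
qed

text \<open>
The neighbourhood of \<open>w\<close> on which \<open>hinge_hessian_secant\<close> applies shrinks as \<open>w\<close> approaches a
kink, but only the limit behaviour at \<open>w\<close> enters the Clarke Jacobian. The neighbourhood of \<open>z\<close> is
uniform.
\<close>

lemma clarke_jacobian_secant:
  assumes "finite J"
  shows "\<forall>\<^sub>F w in nhds z. \<forall>A \<in> clarke_jacobian (hinge_gradient C J a b) w.
           A *v (w - z) = hinge_gradient C J a b w - hinge_gradient C J a b z"
  using eventually_sgn_stable[OF assms, where z = z and a = a and b = b]
proof eventually_elim
  case (elim w)
  have "\<forall>\<^sub>F X in nhds w. hinge_hessian C J a b X *v (w - z)
      = hinge_gradient C J a b w - hinge_gradient C J a b z"
    using eventually_sgn_stable[OF assms, where z = w and a = a and b = b]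
    by eventually_elim (use elim in \<open>auto intro!: hinge_hessian_secant\<close>)
  then have "clarke_jacobian (hinge_gradient C J a b) w
      \<subseteq> {A. A *v (w - z) = hinge_gradient C J a b w - hinge_gradient C J a b z}"
    by (intro clarke_jacobian_subsetI convex_closed_operator_sets)
      (auto simp: jacobian_hinge_gradient assms elim: eventually_mono)
  then show ?case by blast
qed

lemma hinge_differentiable:
  fixes a :: "real ^ 'n"
  assumes "a = 0 \<or> a \<bullet> X \<noteq> b"
  shows "(\<lambda>w. max (a \<bullet> w - b) 0) differentiable (at X)"
proof (cases "a = 0")
  case False
  have lim: "((\<lambda>w. a \<bullet> w - b) \<longlongrightarrow> a \<bullet> X - b) (nhds X)"
    by (intro tendsto_intros filterlim_ident)
  consider "a \<bullet> X - b > 0" | "a \<bullet> X - b < 0" using assms False by fastforce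
  then show ?thesis
  proof cases
    case 1
    have "((\<lambda>w. a \<bullet> w - b) has_derivative (\<lambda>h. a \<bullet> h)) (at X)"
      by (auto intro!: derivative_eq_intros)
    moreover have "\<forall>\<^sub>F w in at X. a \<bullet> w - b = max (a \<bullet> w - b) 0"
      using order_tendstoD(1)[OF lim 1] by (auto simp: eventually_at_filter elim: eventually_mono)
    ultimately have "((\<lambda>w. max (a \<bullet> w - b) 0) has_derivative (\<lambda>h. a \<bullet> h)) (at X)"
      using 1 by (elim has_derivative_transform_eventually) auto
    then show ?thesis by (rule differentiableI)
  next
    case 2
    have "\<forall>\<^sub>F w in at X. 0 = max (a \<bullet> w - b) 0"
      using order_tendstoD(2)[OF lim 2] by (auto simp: eventually_at_filter elim: eventually_mono)
    from has_derivative_transform_eventually[OF has_derivative_const this] 2 show ?thesis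
      by (auto intro: differentiableI)
  qed
qed simp

text \<open>
Points off the finitely many kink hyperplanes are dense, and a sequence of them has bounded
Jacobians, so Bolzano-Weierstrass yields an element of the Bouligand subdifferential. Forms with
\<open>a j = 0\<close> are constant and have no kink; their zero set may be the whole space and is left out.
\<close>

lemma clarke_jacobian_hinge_gradient_nonempty:
  fixes a :: "'j \<Rightarrow> real ^ 'n"
  assumes "finite J"
  shows "clarke_jacobian (hinge_gradient C J a b) w \<noteq> {}"
proof -
  let ?g = "hinge_gradient C J a b"
  let ?K = "\<Union>j\<in>{j\<in>J. a j \<noteq> 0}. {w. a j \<bullet> w = b j}"
  have "negligible ?K"
    using assms by (intro negligible_Union) (auto intro: negligible_hyperplane)
  then have "negligible (interior ?K)" by (rule negligible_subset) (rule interior_subset)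
  then have "interior ?K = {}" using open_not_negligible[of "interior ?K"] by blast
  then have "w \<in> closure (- ?K)" unfolding closure_complement by simp
  then obtain X where X: "\<And>k. X k \<in> - ?K" "X \<longlonglongrightarrow> w" by (auto simp: closure_sequential)
  have diff: "?g differentiable (at (X k))" for k
    unfolding hinge_gradient_def
    by (intro differentiable_add differentiable_ident differentiable_scaleR differentiable_const
        differentiable_sum \<open>finite J\<close> ballI hinge_differentiable) (use X(1)[of k] in auto)
  have "norm (hinge_hessian C J a b X) \<le>
     norm (mat 1 :: real ^ 'n ^ 'n) + \<bar>2 * C\<bar> * (\<Sum>j\<in>J. norm (outer_square (a j)))" for X
  proof -
    let ?B = "\<lambda>j. ((1 + sgn (a j \<bullet> X - b j)) / 2) *\<^sub>R outer_square (a j)"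
    have "norm (\<Sum>j\<in>J. ?B j) \<le> (\<Sum>j\<in>J. norm (outer_square (a j)))"
      by (rule sum_norm_le) (auto simp: sgn_real_def)
    then have "norm ((2 * C) *\<^sub>R (\<Sum>j\<in>J. ?B j)) \<le> \<bar>2 * C\<bar> * (\<Sum>j\<in>J. norm (outer_square (a j)))"
      unfolding norm_scaleR by (rule mult_left_mono) simp
    then show ?thesis
      unfolding hinge_hessian_def by (intro order_trans[OF norm_triangle_ineq] add_left_mono)
  qed
  then have "bounded (range (\<lambda>k. jacobian ?g (at (X k))))"
    by (auto simp: bounded_iff jacobian_hinge_gradient assms diff)
  then obtain A r where "strict_mono (r :: nat \<Rightarrow> nat)" "(\<lambda>k. jacobian ?g (at (X (r k)))) \<longlonglongrightarrow> A"
    using bounded_imp_convergent_subsequence unfolding o_def by blast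
  then have "A \<in> bouligand_subdifferential ?g w"
    unfolding bouligand_subdifferential_def using diff X(2) by blast
  then show ?thesis unfolding clarke_jacobian_def by auto
qed

section \<open>One-step convergence of the Newton method\<close>

lemma coercive_imp_invertible:
  fixes A :: "real ^ 'n ^ 'n"
  assumes "\<And>h. h \<bullet> h \<le> h \<bullet> (A *v h)"
  shows "invertible A"
proof -
  have "h = 0" if "A *v h = 0" for h using assms[of h] that inner_gt_zero_iff[of h] by fastforce
  then show ?thesis
    by (simp add: invertible_left_inverse matrix_left_invertible_ker)
qed

text \<open>
The generalized Hessians are nonempty and consist of invertible matrices at every point, so the
radius \<open>\<delta>\<close> comes from the secant identity alone.
\<close>

lemma newton_hinge_objective:
  assumes "finite J" "0 \<le> C" and f: "f = hinge_objective C J a b" and "gradient f wstar = 0"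
  shows "\<exists>\<delta>>0. \<exists>K>0. \<forall>w0. norm (w0 - wstar) \<le> \<delta> \<longrightarrow>
           newton_well_defined f w0 \<and>
           (\<forall>w V. w 0 = w0 \<and> (\<forall>k. newton_step f (w k) (V k) (w (Suc k))) \<longrightarrow>
              w \<longlonglongrightarrow> wstar \<and>
              (\<forall>k. norm (w (Suc k) - wstar) \<le> K * (norm (w k - wstar))\<^sup>2))"
proof -
  have grad: "gradient f = hinge_gradient C J a b"
    by (simp add: f gradient_hinge_objective)
  have hess: "generalized_hessian f w = clarke_jacobian (hinge_gradient C J a b) w" for w
    by (simp add: generalized_hessian_def grad)
  have inv: "invertible A" if "A \<in> generalized_hessian f w" for A w
    using that unfolding hess
    by (rule coercive_imp_invertible[OF clarke_jacobian_coercive[OF assms(1,2)]])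
  then have wd: "newton_well_defined f w0" for w0
    unfolding newton_well_defined_def
    using inv clarke_jacobian_hinge_gradient_nonempty[OF \<open>finite J\<close>] unfolding hess by blast
  obtain \<delta> where "\<delta> > 0" and \<delta>: "\<And>w A. norm (w - wstar) \<le> \<delta> \<Longrightarrow> A \<in> generalized_hessian f w
      \<Longrightarrow> A *v (w - wstar) = gradient f w"
    using clarke_jacobian_secant[OF \<open>finite J\<close>, where z = wstar and C = C and a = a and b = b]
      \<open>gradient f wstar = 0\<close>
    unfolding eventually_nhds_metric_le dist_norm by (auto simp: hess grad)
  have one_step: "w' = wstar" if "newton_step f w V w'" "norm (w - wstar) \<le> \<delta>" for w V w'
  proof -
    have V: "V \<in> generalized_hessian f w" "invertible V" "w' = w - matrix_inv V *v gradient f w"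
      using that(1) by (auto simp: newton_step_def)
    have "matrix_inv V *v gradient f w = (matrix_inv V ** V) *v (w - wstar)"
      using \<delta>[OF that(2) V(1)] by (simp add: matrix_vector_mul_assoc[symmetric])
    moreover have "matrix_inv V ** V = mat 1"
      using V(2) unfolding invertible_def matrix_inv_def by (rule someI2_ex) simp
    ultimately show ?thesis using V(3) by simp
  qed
  have finite_termination: "w (Suc k) = wstar"
    if "norm (w 0 - wstar) \<le> \<delta>" "\<And>k. newton_step f (w k) (V k) (w (Suc k))" for w V k
  proof (induction k)
    case 0
    show ?case using one_step that by blast
  next
    case (Suc k)
    then show ?case using one_step[OF that(2)] \<open>\<delta> > 0\<close> by simp
  qed
  show ?thesis
    \<comment> \<open>The left-hand side of the rate estimate is zero, so any positive \<open>K\<close> does.\<close>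
  proof (rule exI[of _ \<delta>], intro conjI exI[of _ "1::real"] allI impI wd)
    fix w0 w V assume "norm (w0 - wstar) \<le> \<delta>"
      and "w 0 = w0 \<and> (\<forall>k. newton_step f (w k) (V k) (w (Suc k)))"
    then have *: "w (Suc k) = wstar" for k using finite_termination by blast
    show "w \<longlonglongrightarrow> wstar" by (rule LIMSEQ_imp_Suc) (simp add: *)
    show "norm (w (Suc k) - wstar) \<le> 1 * (norm (w k - wstar))\<^sup>2" for k using * by simp
  qed (use \<open>\<delta> > 0\<close> in auto)
qed

lemma l2_svc_objective_eq:
  "l2_svc_objective C l x y = hinge_objective C {1..l} (\<lambda>i. - y i *\<^sub>R x i) (\<lambda>i. - 1)"
  by (auto simp: fun_eq_iff l2_svc_objective_def hinge_objective_def inner_commute)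

text \<open>
The index \<open>s\<close> selects the side of the insensitivity tube: \<open>s = 1\<close> penalises \<open>w . x i > y i + \<epsilon>\<close> and
\<open>s = -1\<close> penalises \<open>w . x i < y i - \<epsilon>\<close>.
\<close>

lemma l2_svr_objective_eq:
  assumes "0 \<le> \<epsilon>"
  shows "l2_svr_objective C \<epsilon> l x y =
    hinge_objective C ({1..l} \<times> {1, -1}) (\<lambda>(i, s). s *\<^sub>R x i) (\<lambda>(i, s). s * y i + \<epsilon>)"
proof -
  have "(max (\<bar>t\<bar> - \<epsilon>) 0)\<^sup>2 = (max (t - \<epsilon>) 0)\<^sup>2 + (max (- t - \<epsilon>) 0)\<^sup>2" for t
    using assms by (auto simp: max_def abs_real_def)
  then have "(max (\<bar>w \<bullet> x i - y i\<bar> - \<epsilon>) 0)\<^sup>2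
      = (\<Sum>s\<in>{1, -1}. (max (s *\<^sub>R x i \<bullet> w - (s * y i + \<epsilon>)) 0)\<^sup>2)" for w i
    by (simp add: inner_commute algebra_simps)
  then show ?thesis
    unfolding fun_eq_iff l2_svr_objective_def hinge_objective_def
    by (simp only: sum.cartesian_product case_prod_unfold simp_thms)
qed

theorem mainTheorem1:
  fixes f :: "real ^ 'n \<Rightarrow> real"
    and x :: "nat \<Rightarrow> real ^ 'n"
    and y :: "nat \<Rightarrow> real"
    and l :: nat
    and C \<epsilon> :: real
    and wstar :: "real ^ 'n"
  assumes "1 \<le> l" and "0 < C" and "0 < \<epsilon>"
    and "(\<forall>i\<in>{1..l}. y i \<in> {-1, 1}) \<and> f = l2_svc_objective C l x y
          \<or> f = l2_svr_objective C \<epsilon> l x y"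
    and "gradient f wstar = 0"
  shows "\<exists>\<delta>>0. \<exists>K>0. \<forall>w0. norm (w0 - wstar) \<le> \<delta> \<longrightarrow>
           newton_well_defined f w0 \<and>
           (\<forall>w V. w 0 = w0 \<and> (\<forall>k. newton_step f (w k) (V k) (w (Suc k))) \<longrightarrow>
              w \<longlonglongrightarrow> wstar \<and>
              (\<forall>k. norm (w (Suc k) - wstar) \<le> K * (norm (w k - wstar))\<^sup>2))"
proof -
  from assms(4) show ?thesis
  proof
    assume "(\<forall>i\<in>{1..l}. y i \<in> {-1, 1}) \<and> f = l2_svc_objective C l x y"
    then show ?thesis
      using assms(2,5)
      by (intro newton_hinge_objective[OF _ _ _ assms(5)]) (auto simp: l2_svc_objective_eq)
  next
    assume "f = l2_svr_objective C \<epsilon> l x y"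
    then show ?thesis
      using assms(2,3)
      by (intro newton_hinge_objective[OF _ _ _ assms(5)]) (auto simp: l2_svr_objective_eq)
  qed
qed

end
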